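(* Let $G$ be a finite group, let $\mathcal{H}$ be a nonempty set of subgroups of $G$, and fix an error parameter $\delta\in[0,1/2)$. Any sample algorithm that solves $\mathsf{HSP}(G,\mathcal{H})$ from uniform examples with error probability at most $\delta$ must use at least $$\Omega\left(\max\left\{\min_{H \in \mathcal{H}}\frac{\log |\mathcal{H}|}{\log \frac{|G|}{|H|}},\ \min_{H \in \mathcal{H}}\sqrt{\frac{|G|}{|H|}\cdot\frac{\log |\mathcal{H}|}{\log \frac{|G|}{|H|}}}\right\}\right)$$ uniform examples, where the implied constant depends only on $\delta$.
   Context: The hidden subgroup problem $\mathsf{HSP}(G,\mathcal{H})$: $G$ is a finite group, $\mathcal{H}$ a set of candidate subgroups of $G$, and $f:G\to V$ ($V$ a finite set) is an unknown function for which there is a subgroup $H\in\mathcal{H}$ such that for all $x,y\in G$, $f(x)=f(xy)$ iff $y\in H$ (i.e. $f$ is constant on left cosets of $H$ and takes distinct values on distinct left cosets). The goal is to identify $H$. A uniform example is a pair $(x,f(x))$ with $x$ drawn uniformly at random from $G$. A sample algorithm receives $T$ independent uniform examples and outputs a subgroup; it solves the problem with error at most $\delta$ if for every valid $f$ it outputs the hidden subgroup $H$ with probability at least $1-\delta$. The number of uniform examples necessary is the least $T$ for which such an algorithm exists (worst case over $f$). Logarithms are base 2.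
   Formalization: Where H = G, log(|G|/|H|) is 0 and the quotient undefined; the denominator is read as 1 there. V is assumed to have enough labels for each candidate H to be hidden by some f. The constant is stated per carrier type; taking the natural numbers covers all finite groups and V. *)

theory Defs
  imports "HOL-Algebra.Group" "HOL-Probability.Probability"
begin

definition hides :: "'g monoid \<Rightarrow> 'v set \<Rightarrow> ('g \<Rightarrow> 'v) \<Rightarrow> 'g set \<Rightarrow> bool" where
  "hides G V f H \<longleftrightarrow>
     subgroup H G \<and> f \<in> carrier G \<rightarrow> V \<and>
     (\<forall>x\<in>carrier G. \<forall>y\<in>carrier G. f x = f (x \<otimes>\<^bsub>G\<^esub> y) \<longleftrightarrow> y \<in> H)"

definition uniform_example :: "'g monoid \<Rightarrow> ('g \<Rightarrow> 'v) \<Rightarrow> ('g \<times> 'v) pmf" where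
  "uniform_example G f = map_pmf (\<lambda>x. (x, f x)) (pmf_of_set (carrier G))"

text \<open>
  A randomized sample algorithm on \<open>T\<close> examples is a Markov kernel: it maps each possible list of
  examples to a distribution on subgroups. Nothing is required on lists that cannot be received.
\<close>

definition sample_algorithm ::
    "'g monoid \<Rightarrow> 'v set \<Rightarrow> nat \<Rightarrow> (('g \<times> 'v) list \<Rightarrow> 'g set pmf) \<Rightarrow> bool" where
  "sample_algorithm G V T A \<longleftrightarrow>
     (\<forall>s. length s = T \<and> set s \<subseteq> carrier G \<times> V \<longrightarrow> (\<forall>K\<in>set_pmf (A s). subgroup K G))"

definition output_distribution ::
    "'g monoid \<Rightarrow> ('g \<Rightarrow> 'v) \<Rightarrow> nat \<Rightarrow> (('g \<times> 'v) list \<Rightarrow> 'g set pmf) \<Rightarrow> 'g set pmf" where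
  "output_distribution G f T A = bind_pmf (replicate_pmf T (uniform_example G f)) A"

definition solves_HSP ::
    "'g monoid \<Rightarrow> 'v set \<Rightarrow> 'g set set \<Rightarrow> real \<Rightarrow> nat \<Rightarrow> (('g \<times> 'v) list \<Rightarrow> 'g set pmf) \<Rightarrow> bool"
  where
  "solves_HSP G V \<H> \<delta> T A \<longleftrightarrow>
     sample_algorithm G V T A \<and>
     (\<forall>H\<in>\<H>. \<forall>f. hides G V f H \<longrightarrow> pmf (output_distribution G f T A) H \<ge> 1 - \<delta>)"

definition index_ratio :: "'g monoid \<Rightarrow> 'g set \<Rightarrow> real" where
  "index_ratio G H = real (card (carrier G)) / real (card H)"

text \<open>
  The logarithm of the index is used only as a denominator, where \<open>H = carrier G\<close> would give
  division by zero. We read the denominator as 1 in that case, its value at index 2, which is the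
  least index of a proper subgroup. (HOL's convention \<open>x / 0 = 0\<close> would make the bound trivial
  whenever the whole group is a candidate. The value \<open>\<infinity>\<close> would make the square root bound false:
  if \<open>\<H>\<close> consists of the trivial subgroup and \<open>G\<close>, two examples are enough when \<open>\<delta> \<ge> 1 / |G|\<close>.)
\<close>

definition log_index :: "'g monoid \<Rightarrow> 'g set \<Rightarrow> real" where
  "log_index G H = (if H = carrier G then 1 else log 2 (index_ratio G H))"

end

theory Submission
  imports Defs "HOL-Combinatorics.Permutations"
begin

text \<open>
  The adversary composes a hiding function with a uniformly random permutation of \<open>V\<close>, so that the
  labels reveal only which pairs of examples collide. Given the sampled group elements, a randomized
  guess is correct for at most one candidate per collision pattern on average, hence \<open>|\<H>|\<close> is at
  most about the number of possible patterns.

  For the first bound, all indices are at most \<open>m\<close>, so there are at most \<open>m ^ T\<close> patterns. For the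
  second, all indices are at least \<open>n\<close>, so the expected number of collisions is at most \<open>T\<^sup>2 / (2 n)\<close>;
  by Markov's inequality only patterns with at most \<open>K = T\<^sup>2 / (n \<epsilon>)\<close> collisions matter, and there are
  at most \<open>n ^ K * exp (T\<^sup>2 / n)\<close> of these.
\<close>

section \<open>Random relabelling of the values\<close>

lemma bij_betw_extends_to_permutation:
  assumes "finite V" "A \<subseteq> V" "B \<subseteq> V" and h: "bij_betw h A B"
  shows "\<exists>\<sigma>. \<sigma> permutes V \<and> (\<forall>a\<in>A. \<sigma> a = h a)"
proof -
  have "card (V - A) = card (V - B)"
    using assms bij_betw_same_card[OF h] by (simp add: card_Diff_subset finite_subset)
  then obtain k where k: "bij_betw k (V - A) (V - B)"
    using assms(1) by (meson finite_Diff finite_same_card_bij)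
  define \<sigma> where "\<sigma> x = (if x \<in> A then h x else if x \<in> V then k x else x)" for x
  have "bij_betw \<sigma> A B"
    by (rule bij_betw_cong[THEN iffD1, OF _ h]) (simp add: \<sigma>_def)
  moreover have "bij_betw \<sigma> (V - A) (V - B)"
    by (rule bij_betw_cong[THEN iffD1, OF _ k]) (simp add: \<sigma>_def)
  ultimately have "bij_betw \<sigma> (A \<union> (V - A)) (B \<union> (V - B))"
    by (rule bij_betw_combine) auto
  then have "bij_betw \<sigma> V V"
    using assms by (simp add: Un_absorb1 Un_Diff_cancel)
  then have "\<sigma> permutes V"
    by (rule bij_imp_permutes) (use assms in \<open>auto simp: \<sigma>_def\<close>)
  then show ?thesis by (auto simp: \<sigma>_def)
qed

text \<open>The pattern is kept as a set of pairs of positions, not as a partition, so that its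
  cardinality is the number of colliding pairs. Repeated samples of one group element count as
  collisions too.\<close>

definition collisions :: "('a \<Rightarrow> 'b) \<Rightarrow> 'a list \<Rightarrow> (nat \<times> nat) set" where
  "collisions f xs = {(i, j). i < j \<and> j < length xs \<and> f (xs ! i) = f (xs ! j)}"

text \<open>The sampled elements \<open>xs\<close> are frozen here; only the permutation and the
  coins of \<open>A\<close> remain random.\<close>

definition relabelled_output ::
    "'v set \<Rightarrow> (('g \<times> 'v) list \<Rightarrow> 'r pmf) \<Rightarrow> 'g list \<Rightarrow> ('g \<Rightarrow> 'v) \<Rightarrow> 'r pmf" where
  "relabelled_output V A xs f =
     bind_pmf (pmf_of_set {\<pi>. \<pi> permutes V}) (\<lambda>\<pi>. A (map (\<lambda>x. (x, \<pi> (f x))) xs))"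

lemma collisions_eqD:
  assumes "collisions f xs = collisions g xs" "x \<in> set xs" "y \<in> set xs"
  shows "f x = f y \<longleftrightarrow> g x = g y"
proof -
  have *: "f (xs ! i) = f (xs ! j) \<longleftrightarrow> g (xs ! i) = g (xs ! j)" if "i < j" "j < length xs" for i j
    using that assms(1) unfolding collisions_def by (auto simp: set_eq_iff)
  obtain i j where "i < length xs" "x = xs ! i" "j < length xs" "y = xs ! j"
    using assms(2,3) by (auto simp: in_set_conv_nth)
  then show ?thesis using *[of i j] *[of j i] by (metis linorder_neqE_nat)
qed

text \<open>With equal patterns, sending \<open>f x\<close> to \<open>g x\<close> is a well-defined
  bijection between the two sets of labels seen. It extends to a permutation of \<open>V\<close>,
  and composing a uniformly random permutation with a fixed one leaves it uniform.\<close>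

lemma relabelled_output_cong:
  assumes "finite V" "f ` set xs \<subseteq> V" "g ` set xs \<subseteq> V" "collisions f xs = collisions g xs"
  shows "relabelled_output V A xs f = relabelled_output V A xs g"
proof -
  define h where "h v = g (inv_into (set xs) f v)" for v
  have eq: "f x = f y \<longleftrightarrow> g x = g y" if "x \<in> set xs" "y \<in> set xs" for x y
    using collisions_eqD[OF assms(4) that] .
  have h: "h (f x) = g x" if "x \<in> set xs" for x
    using that eq by (metis f_inv_into_f h_def image_eqI inv_into_into)
  have "bij_betw h (f ` set xs) (g ` set xs)"
    by (rule bij_betw_imageI) (auto simp: inj_on_def h eq image_image)
  from bij_betw_extends_to_permutation[OF assms(1-3) this]
  obtain \<sigma> where \<sigma>: "\<sigma> permutes V" "\<And>x. x \<in> set xs \<Longrightarrow> \<sigma> (f x) = g x"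
    using h by auto
  have bij: "bij_betw (\<lambda>p. p \<circ> \<sigma>) {p. p permutes V} {p. p permutes V}"
    by (rule bij_betw_byWitness[where f' = "\<lambda>p. p \<circ> inv_into UNIV \<sigma>"])
      (auto simp: comp_assoc permutes_inv_o[OF \<sigma>(1)] intro: permutes_compose \<sigma>(1) permutes_inv)
  have "{p. p permutes V} \<noteq> {}" using \<sigma>(1) by auto
  from map_pmf_of_set_bij_betw[OF bij this finite_permutations[OF assms(1)]]
  have "relabelled_output V A xs f =
    bind_pmf (map_pmf (\<lambda>p. p \<circ> \<sigma>) (pmf_of_set {\<pi>. \<pi> permutes V})) (\<lambda>\<pi>. A (map (\<lambda>x. (x, \<pi> (f x))) xs))"
    by (simp add: relabelled_output_def)
  also have "\<dots> = relabelled_output V A xs g"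
    by (auto simp: relabelled_output_def bind_map_pmf \<sigma>(2) cong: map_cong)
  finally show ?thesis .
qed

text \<open>Candidates sharing a pattern share one output distribution, so their success
  probabilities are masses of distinct outcomes under it and sum to at most 1. Each pattern thus
  contributes at most 1.\<close>

lemma sum_pmf_relabelled_output_le:
  assumes "finite V" "finite S" "\<And>H. H \<in> S \<Longrightarrow> F H ` set xs \<subseteq> V"
  shows "(\<Sum>H\<in>S. pmf (relabelled_output V A xs (F H)) H) \<le> card ((\<lambda>H. collisions (F H) xs) ` S)"
proof -
  let ?q = "\<lambda>H. pmf (relabelled_output V A xs (F H)) H" and ?c = "\<lambda>H. collisions (F H) xs"
  have "sum ?q S = (\<Sum>E\<in>?c ` S. sum ?q {H \<in> S. ?c H = E})"
    by (rule sum.image_gen[OF assms(2)])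
  also have "\<dots> \<le> (\<Sum>E\<in>?c ` S. 1)"
  proof (rule sum_mono)
    fix E assume "E \<in> ?c ` S"
    then obtain K where K: "K \<in> S" "E = ?c K" by auto
    have "sum ?q {H \<in> S. ?c H = E} = (\<Sum>H\<in>{H \<in> S. ?c H = E}. pmf (relabelled_output V A xs (F K)) H)"
      using K assms by (intro sum.cong refl arg_cong2[where f = pmf] relabelled_output_cong) auto
    also have "\<dots> \<le> 1"
      using assms(2) by (subst measure_measure_pmf_finite[symmetric]) auto
    finally show "sum ?q {H \<in> S. ?c H = E} \<le> 1" .
  qed
  finally show ?thesis by simp
qed

section \<open>Uniform samples as uniformly random lists\<close>

abbreviation lists_of_length :: "'a set \<Rightarrow> nat \<Rightarrow> 'a list set" where
  "lists_of_length X T \<equiv> {xs. set xs \<subseteq> X \<and> length xs = T}"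

lemma lists_of_length_ne: "X \<noteq> {} \<Longrightarrow> lists_of_length X T \<noteq> {}"
proof -
  assume "X \<noteq> {}"
  then obtain x where "x \<in> X" by auto
  then have "replicate T x \<in> lists_of_length X T" by auto
  then show ?thesis by blast
qed

text \<open>This turns probabilities over the samples into finite sums over lists, where summation
  can be exchanged freely.\<close>

lemma replicate_pmf_of_set:
  assumes "finite X" "X \<noteq> {}"
  shows "replicate_pmf T (pmf_of_set X) = pmf_of_set (lists_of_length X T)"
proof (induction T)
  case 0
  have "lists_of_length X 0 = {[]}" by auto
  then show ?case by (simp add: pmf_of_set_singleton)
next
  case (Suc T)
  show ?case
  proof (rule pmf_eqI)
    fix ys
    have fin: "finite (lists_of_length X n)" for n by (rule finite_lists_length_eq[OF assms(1)])
    have ne: "lists_of_length X n \<noteq> {}" for n by (rule lists_of_length_ne[OF assms(2)])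
    have "pmf (replicate_pmf (Suc T) (pmf_of_set X)) ys =
      (\<Sum>x\<in>X. (\<Sum>xs\<in>lists_of_length X T. indicator {x # xs} ys) / card X ^ T) / card X"
      using assms fin[of T] ne[of T]
      by (simp add: Suc pmf_bind integral_pmf_of_set card_lists_length_eq indicator_def if_distrib
          pmf_return eq_commute[of ys] sum_divide_distrib mult.commute)
    also have "\<dots> = (\<Sum>x\<in>X. \<Sum>xs\<in>lists_of_length X T. indicator {x # xs} ys) / card X ^ Suc T"
      by (simp add: sum_divide_distrib[symmetric] divide_divide_eq_left mult.commute)
    also have "(\<Sum>x\<in>X. \<Sum>xs\<in>lists_of_length X T. indicator {x # xs} ys) =
        (\<Sum>zs\<in>lists_of_length X (Suc T). indicator {zs} ys :: real)"
      unfolding lists_length_Suc_eq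
      by (subst sum.swap, subst sum.reindex)
        (auto simp: inj_on_def case_prod_unfold sum.cartesian_product)
    also have "\<dots> = indicator (lists_of_length X (Suc T)) ys"
      using fin[of "Suc T"] by (auto simp: indicator_def sum.delta)
    also have "\<dots> / card X ^ Suc T = pmf (pmf_of_set (lists_of_length X (Suc T))) ys"
      using fin[of "Suc T"] ne[of "Suc T"] assms by (simp add: card_lists_length_eq del: power_Suc)
    finally show "pmf (replicate_pmf (Suc T) (pmf_of_set X)) ys =
      pmf (pmf_of_set (lists_of_length X (Suc T))) ys" .
  qed
qed

lemma replicate_map_pmf: "replicate_pmf n (map_pmf h p) = map_pmf (map h) (replicate_pmf n p)"
  by (induction n) (simp_all add: map_pmf_def bind_assoc_pmf bind_return_pmf)

lemma output_distribution_eq: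
  assumes "finite (carrier G)" "carrier G \<noteq> {}"
  shows "output_distribution G f T A =
    bind_pmf (pmf_of_set (lists_of_length (carrier G) T)) (\<lambda>xs. A (map (\<lambda>x. (x, f x)) xs))"
  unfolding output_distribution_def uniform_example_def replicate_map_pmf
    replicate_pmf_of_set[OF assms] bind_map_pmf ..

lemma hides_permuted:
  assumes "hides G V f H" "\<pi> permutes V"
  shows "hides G V (\<lambda>x. \<pi> (f x)) H"
  using assms permutes_in_image[OF assms(2)] inj_eq[OF permutes_inj[OF assms(2)]]
  unfolding hides_def by (auto simp: Pi_iff)

text \<open>The guarantee is worst case, so it holds for every relabelling of \<open>f\<close>, each
  of which hides the same \<open>H\<close>. Averaging over the permutations and drawing the samples
  first gives the sum, with the denominator cleared.\<close>

lemma average_relabelled_success: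
  fixes G :: "'g monoid"
  assumes "finite (carrier G)" "carrier G \<noteq> {}" "finite V"
    and solves: "solves_HSP G V \<H> \<delta> T A" and "H \<in> \<H>" and f: "hides G V f H"
  shows "(1 - \<delta>) * card (carrier G) ^ T \<le>
    (\<Sum>xs\<in>lists_of_length (carrier G) T. pmf (relabelled_output V A xs f) H)"
proof -
  let ?P = "{\<pi>. \<pi> permutes V}" and ?L = "lists_of_length (carrier G) T"
  have P: "finite ?P" "?P \<noteq> {}"
    using finite_permutations[OF assms(3)] permutes_id[of V] by blast+
  have L: "finite ?L" "?L \<noteq> {}"
    using finite_lists_length_eq[OF assms(1)] lists_of_length_ne[OF assms(2)] by auto
  have "1 - \<delta> = (\<Sum>\<pi>\<in>?P. 1 - \<delta>) / card ?P"
    using P by simp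
  also have "\<dots> \<le> (\<Sum>\<pi>\<in>?P. pmf (output_distribution G (\<lambda>x. \<pi> (f x)) T A) H) / card ?P"
  proof (intro divide_right_mono sum_mono)
    fix \<pi> assume "\<pi> \<in> ?P"
    then have "hides G V (\<lambda>x. \<pi> (f x)) H"
      using hides_permuted[OF f] by auto
    then show "1 - \<delta> \<le> pmf (output_distribution G (\<lambda>x. \<pi> (f x)) T A) H"
      using solves \<open>H \<in> \<H>\<close> unfolding solves_HSP_def by auto
  qed simp
  also have "\<dots> = pmf (bind_pmf (pmf_of_set ?P) (\<lambda>\<pi>. output_distribution G (\<lambda>x. \<pi> (f x)) T A)) H"
    using P by (simp add: pmf_bind integral_pmf_of_set)
  also have "\<dots> = pmf (bind_pmf (pmf_of_set ?L) (\<lambda>xs. relabelled_output V A xs f)) H"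
    unfolding output_distribution_eq[OF assms(1,2)] relabelled_output_def
    by (subst bind_commute_pmf) (rule refl)
  also have "\<dots> = (\<Sum>xs\<in>?L. pmf (relabelled_output V A xs f) H) / card (carrier G) ^ T"
    using L by (simp add: pmf_bind integral_pmf_of_set card_lists_length_eq[OF assms(1)])
  finally show ?thesis
    using assms(1,2) by (simp add: pos_le_divide_eq card_gt_0_iff)
qed

section \<open>Fibres of a hiding function\<close>

text \<open>The fibre through \<open>y\<close> is the left coset of \<open>H\<close> containing
  \<open>y\<close>.\<close>

lemma card_fibre:
  assumes "group G" "hides G V f H" "y \<in> carrier G"
  shows "card {x \<in> carrier G. f x = f y} = card H"
proof -
  interpret group G by fact
  have H: "H \<subseteq> carrier G" and eq: "\<And>x z. x \<in> carrier G \<Longrightarrow> z \<in> carrier G \<Longrightarrow> f x = f (x \<otimes>\<^bsub>G\<^esub> z) \<longleftrightarrow> z \<in> H"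
    using assms(2) by (auto simp: hides_def subgroup.subset dest: subgroup.mem_carrier)
  have "{x \<in> carrier G. f x = f y} = (\<lambda>h. y \<otimes>\<^bsub>G\<^esub> h) ` H"
  proof (intro Set.set_eqI iffI)
    fix x assume x: "x \<in> {x \<in> carrier G. f x = f y}"
    let ?h = "inv\<^bsub>G\<^esub> y \<otimes>\<^bsub>G\<^esub> x"
    have "x = y \<otimes>\<^bsub>G\<^esub> ?h" using x assms(3) by (simp add: m_assoc[symmetric])
    moreover from this have "?h \<in> H" using eq[of y ?h] x assms(3) by auto
    ultimately show "x \<in> (\<lambda>h. y \<otimes>\<^bsub>G\<^esub> h) ` H" by blast
  next
    fix x assume "x \<in> (\<lambda>h. y \<otimes>\<^bsub>G\<^esub> h) ` H"
    then obtain h where h: "h \<in> H" "x = y \<otimes>\<^bsub>G\<^esub> h" by auto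
    then have "f y = f x" using eq[of y h] H assms(3) by auto
    then show "x \<in> {x \<in> carrier G. f x = f y}" using h H assms(3) by auto
  qed
  moreover have "inj_on (\<lambda>h. y \<otimes>\<^bsub>G\<^esub> h) H"
    using H assms(3) by (intro inj_onI) (auto simp: subset_iff)
  ultimately show ?thesis by (simp add: card_image)
qed

lemma card_image_hiding:
  assumes "group G" "finite (carrier G)" "hides G V f H"
  shows "card (f ` carrier G) * card H = card (carrier G)"
proof -
  have "card (carrier G) = (\<Sum>x\<in>carrier G. 1)" by simp
  also have "\<dots> = (\<Sum>v\<in>f ` carrier G. \<Sum>x\<in>{x \<in> carrier G. f x = v}. 1)"
    by (rule sum.image_gen[OF assms(2)])
  also have "\<dots> = (\<Sum>v\<in>f ` carrier G. card H)"
    using card_fibre[OF assms(1,3)] by (intro sum.cong) auto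
  finally show ?thesis by simp
qed

section \<open>The expected number of collisions\<close>

lemma collisions_Cons:
  "collisions f (x # xs) = map_prod Suc Suc ` collisions f xs \<union>
     (\<lambda>j. (0, Suc j)) ` {j. j < length xs \<and> f x = f (xs ! j)}"
  (is "_ = ?A \<union> ?B")
proof (intro Set.set_eqI iffI)
  fix p assume p: "p \<in> collisions f (x # xs)"
  obtain i j where ij: "p = (i, Suc j)" "i < Suc j" "j < length xs" "f ((x # xs) ! i) = f (xs ! j)"
    using p by (auto simp: collisions_def gr0_conv_Suc elim!: less_natE)
  show "p \<in> ?A \<union> ?B"
    using ij by (cases i) (auto simp: collisions_def image_iff)
qed (auto simp: collisions_def)

lemma finite_collisions [simp]: "finite (collisions f xs)"
  by (rule finite_subset[of _ "{..<length xs} \<times> {..<length xs}"]) (auto simp: collisions_def)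

lemma card_collisions_Cons:
  "card (collisions f (x # xs)) =
     card (collisions f xs) + card {j. j < length xs \<and> f x = f (xs ! j)}"
  unfolding collisions_Cons
  by (subst card_Un_disjoint) (auto simp: card_image inj_on_def map_prod_def case_prod_unfold prod_eq_iff)

text \<open>Each of the \<open>T choose 2\<close> pairs of positions collides with probability
  \<open>h / card X\<close>; multiplying out the denominators keeps the identity in the natural
  numbers. The induction adds the \<open>T\<close> pairs that involve the new head, as in Pascal's
  rule.\<close>

lemma sum_card_collisions:
  assumes "finite X" "\<And>y. y \<in> X \<Longrightarrow> card {x \<in> X. f x = f y} = h"
  shows "(\<Sum>xs\<in>lists_of_length X T. card (collisions f xs)) * card X =
    (T choose 2) * h * card X ^ T"
proof (induction T)
  case 0
  have "lists_of_length X 0 = {[]}" by auto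
  then show ?case by (simp add: collisions_def)
next
  case (Suc T)
  let ?L = "lists_of_length X T"
  have fin: "finite ?L" by (rule finite_lists_length_eq[OF assms(1)])
  have col: "(\<Sum>x\<in>X. card {j. j < T \<and> f x = f (xs ! j)}) = T * h" if "xs \<in> ?L" for xs
  proof -
    have "(\<Sum>x\<in>X. card {j. j < T \<and> f x = f (xs ! j)}) = (\<Sum>x\<in>X. \<Sum>j<T. if f x = f (xs ! j) then 1 else 0)"
      by (simp add: sum.If_cases Int_def)
    also have "\<dots> = (\<Sum>j<T. \<Sum>x\<in>X. if f x = f (xs ! j) then 1 else 0)"
      by (rule sum.swap)
    also have "\<dots> = (\<Sum>j<T. card {x \<in> X. f x = f (xs ! j)})"
      using assms(1) by (simp add: sum.If_cases Int_def)
    also have "\<dots> = (\<Sum>j<T. h)"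
      using that by (intro sum.cong assms(2)) (auto simp: subset_iff)
    finally show ?thesis by simp
  qed
  have "(\<Sum>xs\<in>lists_of_length X (Suc T). card (collisions f xs)) =
      (\<Sum>xs\<in>?L. \<Sum>x\<in>X. card (collisions f (x # xs)))"
    unfolding lists_length_Suc_eq
    by (subst sum.reindex) (auto simp: inj_on_def case_prod_unfold sum.cartesian_product)
  also have "\<dots> = (\<Sum>xs\<in>?L. card X * card (collisions f xs) + T * h)"
    using col by (intro sum.cong refl) (simp add: card_collisions_Cons sum.distrib)
  also have "\<dots> = card X * (\<Sum>xs\<in>?L. card (collisions f xs)) + card X ^ T * (T * h)"
    by (simp add: sum.distrib sum_distrib_left card_lists_length_eq[OF assms(1)])
  finally have "(\<Sum>xs\<in>lists_of_length X (Suc T). card (collisions f xs)) =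
    (T choose 2) * h * card X ^ T + card X ^ T * (T * h)"
    using Suc by (simp add: mult.commute)
  then show ?case by (simp add: numeral_2_eq_2 algebra_simps)
qed

section \<open>Counting small subsets\<close>

lemma sum_Pow_power_card:
  fixes t :: real
  assumes "finite X"
  shows "(\<Sum>S\<in>Pow X. t ^ card S) = (1 + t) ^ card X"
  using prod_add[OF assms, of "\<lambda>_. t" "\<lambda>_. 1"] by (simp add: add.commute)

text \<open>In use, \<open>X\<close> consists of the \<open>T * T\<close> pairs of positions and
  \<open>n\<close> is the least index. For \<open>K\<close> of order \<open>T * T / n\<close>, the
  logarithm of the bound is then of order \<open>T * T / n\<close> times the logarithm of the
  index.\<close>

lemma card_small_subsets_le:
  fixes n K :: real
  assumes "finite X" "n \<ge> 1"
  shows "card {S. S \<subseteq> X \<and> card S \<le> K} \<le> n powr K * exp (card X / n)"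
proof -
  let ?\<S> = "{S. S \<subseteq> X \<and> card S \<le> K}"
  have fin: "finite ?\<S>" using assms(1) by simp
  have "real (card ?\<S>) = (\<Sum>S\<in>?\<S>. 1)" by simp
  \<comment> \<open>Each small set gets weight at least 1; the weighted sum over all subsets is a binomial power.\<close>
  also have "\<dots> \<le> (\<Sum>S\<in>?\<S>. n powr K * (1 / n) ^ card S)"
  proof (rule sum_mono)
    fix S assume "S \<in> ?\<S>"
    then have "n powr card S \<le> n powr K" using assms(2) by (intro powr_mono) auto
    then show "1 \<le> n powr K * (1 / n) ^ card S"
      using assms(2) by (simp add: powr_realpow field_simps)
  qed
  also have "\<dots> \<le> (\<Sum>S\<in>Pow X. n powr K * (1 / n) ^ card S)"
    using assms by (intro sum_mono2) auto
  also have "\<dots> = n powr K * (1 + 1 / n) ^ card X"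
    by (simp add: sum_distrib_left[symmetric] sum_Pow_power_card[OF assms(1)])
  also have "\<dots> \<le> n powr K * exp (1 / n) ^ card X"
    using assms(2) by (intro mult_left_mono power_mono exp_ge_add_one_self) auto
  also have "exp (1 / n) ^ card X = exp (card X / n)"
    by (simp add: exp_of_nat_mult[symmetric])
  finally show ?thesis .
qed

section \<open>The index and its logarithm\<close>

lemma index_ratio_eq_card_image:
  assumes "group G" "finite (carrier G)" "hides G V f H"
  shows "index_ratio G H = card (f ` carrier G)"
proof -
  interpret group G by fact
  have "card (carrier G) > 0" using assms(2) by (auto simp: card_gt_0_iff)
  then have "card H > 0"
    using card_image_hiding[OF assms] by (auto intro: gr0I)
  then show ?thesis
    using card_image_hiding[OF assms] unfolding index_ratio_def
    by (simp add: field_simps flip: of_nat_mult)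
qed

text \<open>A proper subgroup has index at least 2, so its logarithm is at least 1; for the whole
  group the default value 1 of \<open>log_index\<close> dominates the true logarithm 0.\<close>

lemma log_index_bounds:
  assumes "group G" "finite (carrier G)" "hides G V f H"
  shows "1 \<le> index_ratio G H" "1 \<le> log_index G H" "log 2 (index_ratio G H) \<le> log_index G H"
proof -
  interpret group G by fact
  have H: "H \<subseteq> carrier G" using assms(3) by (auto simp: hides_def dest: subgroup.subset)
  note ind = index_ratio_eq_card_image[OF assms]
  have "f ` carrier G \<noteq> {}" by auto
  then have pos: "card (f ` carrier G) \<ge> 1"
    using assms(2) by (simp add: card_gt_0_iff Suc_le_eq)
  then show 1: "1 \<le> index_ratio G H" by (simp add: ind)
  have *: "2 \<le> index_ratio G H" if "H \<noteq> carrier G"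
  proof -
    have "card (f ` carrier G) \<noteq> 1"
      using card_image_hiding[OF assms] card_subset_eq[OF assms(2) H] that by auto
    then have "card (f ` carrier G) \<ge> 2" using pos by linarith
    then show ?thesis by (simp add: ind)
  qed
  show "1 \<le> log_index G H"
    using * by (cases "H = carrier G") (simp_all add: log_index_def le_log_iff)
  have "index_ratio G H = 1" if "H = carrier G"
    using that assms(2) \<open>f ` carrier G \<noteq> {}\<close> by (auto simp: index_ratio_def)
  then show "log 2 (index_ratio G H) \<le> log_index G H"
    by (auto simp: log_index_def)
qed

section \<open>Bounding the number of candidates by collision patterns\<close>

lemma collisions_map: "collisions f xs = collisions id (map f xs)"
  by (auto simp: collisions_def)

lemma collisions_comp_inj:
  assumes "inj_on e (f ` set xs)"
  shows "collisions (e \<circ> f) xs = collisions f xs"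
  using assms by (auto simp: collisions_def inj_on_def)

text \<open>At most \<open>m\<close> labels can be renamed injectively into \<open>{..<m}\<close>
  without changing the pattern, so every pattern is that of a word of length \<open>T\<close> over
  \<open>m\<close> letters.\<close>

lemma card_collision_patterns_le:
  assumes "finite X" "\<And>H. H \<in> S \<Longrightarrow> card (F H ` X) \<le> m" "xs \<in> lists_of_length X T"
  shows "card ((\<lambda>H. collisions (F H) xs) ` S) \<le> m ^ T"
proof -
  let ?L = "lists_of_length {..<m} T"
  have fin: "finite ?L" by (rule finite_lists_length_eq) simp
  have "(\<lambda>H. collisions (F H) xs) ` S \<subseteq> collisions id ` ?L"
  proof (rule image_subsetI)
    fix H assume "H \<in> S"
    then obtain e where e: "e ` (F H ` X) \<subseteq> {..<m}" "inj_on e (F H ` X)"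
      using card_le_inj[of "F H ` X" "{..<m}"] assms(1,2) by auto
    have "inj_on e (F H ` set xs)"
      using assms(3) by (intro inj_on_subset[OF e(2)]) auto
    then have "collisions (F H) xs = collisions id (map (e \<circ> F H) xs)"
      by (simp only: collisions_map[symmetric] collisions_comp_inj)
    moreover have "map (e \<circ> F H) xs \<in> ?L" using e(1) assms(3) by auto
    ultimately show "collisions (F H) xs \<in> collisions id ` ?L" by blast
  qed
  then have "card ((\<lambda>H. collisions (F H) xs) ` S) \<le> card (collisions id ` ?L)"
    using fin by (intro card_mono) auto
  also have "\<dots> \<le> card ?L" by (rule card_image_le[OF fin])
  finally show ?thesis by (simp add: card_lists_length_eq)
qed

text \<open>The success probabilities are summed over candidates and sample lists in both orders:
  per candidate the guarantee bounds the sum below, per list the number of patterns bounds it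
  above.\<close>

lemma card_candidates_le_power:
  assumes "group G" "finite (carrier G)" "finite V" "finite \<H>"
    and hides: "\<And>H. H \<in> \<H> \<Longrightarrow> hides G V (F H) H"
    and solves: "solves_HSP G V \<H> \<delta> T A"
    and m: "\<And>H. H \<in> \<H> \<Longrightarrow> index_ratio G H \<le> real m"
  shows "(1 - \<delta>) * card \<H> \<le> real m ^ T"
proof -
  have img: "f ` set xs \<subseteq> V" if "hides G V f H" "set xs \<subseteq> carrier G" for f H xs
    using that by (auto simp: hides_def)
  interpret group G by fact
  let ?L = "lists_of_length (carrier G) T" and ?N = "real (card (carrier G) ^ T)"
  have "carrier G \<noteq> {}" by auto
  then have N: "?N > 0" using assms(2) by (simp add: card_gt_0_iff)
  have "(1 - \<delta>) * card \<H> * ?N = (\<Sum>H\<in>\<H>. (1 - \<delta>) * card (carrier G) ^ T)" by simp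
  also have "\<dots> \<le> (\<Sum>H\<in>\<H>. \<Sum>xs\<in>?L. pmf (relabelled_output V A xs (F H)) H)"
    using average_relabelled_success[OF assms(2) \<open>carrier G \<noteq> {}\<close> assms(3) solves _ hides]
    by (intro sum_mono) auto
  also have "\<dots> = (\<Sum>xs\<in>?L. \<Sum>H\<in>\<H>. pmf (relabelled_output V A xs (F H)) H)"
    by (rule sum.swap)
  also have "\<dots> \<le> (\<Sum>xs\<in>?L. real m ^ T)"
  proof (rule sum_mono)
    fix xs assume xs: "xs \<in> ?L"
    have "(\<Sum>H\<in>\<H>. pmf (relabelled_output V A xs (F H)) H) \<le> card ((\<lambda>H. collisions (F H) xs) ` \<H>)"
      using img[OF hides] xs assms(3,4) by (intro sum_pmf_relabelled_output_le) auto
    also have "card ((\<lambda>H. collisions (F H) xs) ` \<H>) \<le> m ^ T"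
      using m index_ratio_eq_card_image[OF assms(1,2) hides]
      by (intro card_collision_patterns_le[OF assms(2) _ xs]) force
    finally show "(\<Sum>H\<in>\<H>. pmf (relabelled_output V A xs (F H)) H) \<le> real m ^ T" by simp
  qed
  also have "\<dots> = real m ^ T * ?N" by (simp add: card_lists_length_eq[OF assms(2)])
  finally show ?thesis using N by simp
qed

text \<open>Markov's inequality: the mean number of collisions is at most \<open>T * T / n\<close>,
  and the threshold is \<open>1 / \<epsilon>\<close> times that.\<close>

lemma card_many_collisions_le:
  fixes n \<epsilon> :: real
  assumes "group G" "finite (carrier G)" "hides G V f H"
    and n: "1 \<le> n" "n \<le> index_ratio G H" and "0 < \<epsilon>" "0 < T"
  shows "card {xs \<in> lists_of_length (carrier G) T. card (collisions f xs) > (real T)\<^sup>2 / (n * \<epsilon>)} \<le>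
    \<epsilon> * card (carrier G) ^ T"
proof -
  interpret group G by fact
  let ?L = "lists_of_length (carrier G) T" and ?N = "real (card (carrier G) ^ T)"
  define K where "K = (real T)\<^sup>2 / (n * \<epsilon>)"
  let ?B = "{xs \<in> ?L. card (collisions f xs) > K}"
  have G: "card (carrier G) > 0" using assms(2) by (auto simp: card_gt_0_iff)
  have K: "K > 0" using assms by (simp add: K_def)
  have fin: "finite ?L" by (rule finite_lists_length_eq[OF assms(2)])
  have ratio: "card H / card (carrier G) \<le> 1 / n"
  proof -
    have "card H > 0" using n G by (auto simp: index_ratio_def intro: gr0I)
    then show ?thesis using n G by (simp add: index_ratio_def field_simps)
  qed
  have "K * card ?B = (\<Sum>xs\<in>?B. K)" by simp
  also have "\<dots> \<le> (\<Sum>xs\<in>?B. real (card (collisions f xs)))"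
    by (intro sum_mono) auto
  also have "\<dots> \<le> (\<Sum>xs\<in>?L. real (card (collisions f xs)))"
    using fin by (intro sum_mono2) auto
  also have "\<dots> = real (T choose 2) * (card H / card (carrier G)) * ?N"
  proof -
    have "(\<Sum>xs\<in>?L. card (collisions f xs)) * card (carrier G) = (T choose 2) * card H * card (carrier G) ^ T"
      by (rule sum_card_collisions[OF assms(2) card_fibre[OF assms(1,3)]])
    from arg_cong[OF this, of real] G show ?thesis
      by (simp add: field_simps)
  qed
  also have "\<dots> \<le> (real T)\<^sup>2 * (1 / n) * ?N"
  proof (intro mult_right_mono mult_mono ratio)
    have "T choose 2 \<le> T\<^sup>2"
      by (cases "2 \<le> T") (auto simp: binomial_eq_0 intro: binomial_le_pow)
    then show "real (T choose 2) \<le> (real T)\<^sup>2" by (simp flip: of_nat_power)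
  qed auto
  also have "\<dots> = K * (\<epsilon> * ?N)" using assms by (simp add: K_def)
  finally have "card ?B \<le> \<epsilon> * ?N" using K by (simp only: mult_le_cancel_left_pos)
  then show ?thesis by (simp add: K_def)
qed

text \<open>The same double summation, restricted for each candidate to the lists on which it has
  few collisions. The discarded lists cost each candidate at most \<epsilon>, and only small
  patterns remain to be counted.\<close>

lemma card_candidates_le_small_patterns:
  fixes n \<epsilon> :: real
  assumes "group G" "finite (carrier G)" "finite V" "finite \<H>"
    and hides: "\<And>H. H \<in> \<H> \<Longrightarrow> hides G V (F H) H"
    and solves: "solves_HSP G V \<H> \<delta> T A"
    and n: "1 \<le> n" "\<And>H. H \<in> \<H> \<Longrightarrow> n \<le> index_ratio G H" and "0 < \<epsilon>" "0 < T"
  shows "(1 - \<delta> - \<epsilon>) * card \<H> \<le>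
    card {S. S \<subseteq> {..<T} \<times> {..<T} \<and> card S \<le> (real T)\<^sup>2 / (n * \<epsilon>)}" (is "_ \<le> real (card ?\<S>)")
proof -
  have img: "f ` set xs \<subseteq> V" if "hides G V f H" "set xs \<subseteq> carrier G" for f H xs
    using that by (auto simp: hides_def)
  interpret group G by fact
  let ?L = "lists_of_length (carrier G) T" and ?N = "real (card (carrier G) ^ T)"
  let ?q = "\<lambda>xs H. pmf (relabelled_output V A xs (F H)) H"
  let ?small = "\<lambda>H xs. card (collisions (F H) xs) \<le> (real T)\<^sup>2 / (n * \<epsilon>)"
  have ne: "carrier G \<noteq> {}" by auto
  then have N: "?N > 0" using assms(2) by (simp add: card_gt_0_iff)
  have finL: "finite ?L" by (rule finite_lists_length_eq[OF assms(2)])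
  have one: "(1 - \<delta> - \<epsilon>) * ?N \<le> (\<Sum>xs\<in>?L. if ?small H xs then ?q xs H else 0)" if H: "H \<in> \<H>" for H
  proof -
    have "(1 - \<delta>) * ?N \<le> (\<Sum>xs\<in>?L. ?q xs H)"
      using average_relabelled_success[OF assms(2) ne assms(3) solves H hides[OF H]] by simp
    \<comment> \<open>On lists with many collisions the success probability is replaced by the
      trivial bound 1.\<close>
    also have "\<dots> \<le> (\<Sum>xs\<in>?L. (if ?small H xs then ?q xs H else 0) + (if ?small H xs then 0 else 1))"
      by (intro sum_mono) (auto simp: pmf_le_1)
    also have "\<dots> = (\<Sum>xs\<in>?L. if ?small H xs then ?q xs H else 0) + card {xs \<in> ?L. \<not> ?small H xs}"
      using finL by (simp add: sum.distrib sum.If_cases Int_def)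
    also have "card {xs \<in> ?L. \<not> ?small H xs} \<le> \<epsilon> * ?N"
      using card_many_collisions_le[OF assms(1,2) hides[OF H] n(1) n(2)[OF H] assms(9,10)]
      by (simp add: not_le)
    finally show ?thesis by (simp add: algebra_simps)
  qed
  have fin\<S>: "finite ?\<S>" by simp
  have "(1 - \<delta> - \<epsilon>) * card \<H> * ?N = (\<Sum>H\<in>\<H>. (1 - \<delta> - \<epsilon>) * ?N)" by simp
  also have "\<dots> \<le> (\<Sum>H\<in>\<H>. \<Sum>xs\<in>?L. if ?small H xs then ?q xs H else 0)"
    using one by (intro sum_mono) auto
  also have "\<dots> = (\<Sum>xs\<in>?L. \<Sum>H\<in>\<H>. if ?small H xs then ?q xs H else 0)"
    by (rule sum.swap)
  also have "\<dots> \<le> (\<Sum>xs\<in>?L. real (card ?\<S>))"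
  proof (rule sum_mono)
    fix xs assume xs: "xs \<in> ?L"
    let ?S = "{H \<in> \<H>. ?small H xs}"
    have "(\<Sum>H\<in>\<H>. if ?small H xs then ?q xs H else 0) = (\<Sum>H\<in>?S. ?q xs H)"
      using assms(4) by (simp add: sum.If_cases Int_def)
    also have "\<dots> \<le> card ((\<lambda>H. collisions (F H) xs) ` ?S)"
      using img[OF hides] xs assms(3,4) by (intro sum_pmf_relabelled_output_le) auto
    also have "card ((\<lambda>H. collisions (F H) xs) ` ?S) \<le> card ?\<S>"
      using xs by (intro card_mono[OF fin\<S>]) (auto simp: collisions_def)
    finally show "(\<Sum>H\<in>\<H>. if ?small H xs then ?q xs H else 0) \<le> real (card ?\<S>)" by simp
  qed
  also have "\<dots> = card ?\<S> * ?N" by (simp add: card_lists_length_eq[OF assms(2)])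
  finally show ?thesis using N by simp
qed

section \<open>Lower bounds on the number of examples\<close>

text \<open>The witness is a candidate of largest index, whose index bounds the number of labels for
  all candidates at once.\<close>

lemma information_bound:
  assumes "group G" "finite (carrier G)" "finite V" "finite \<H>" "0 \<le> \<delta>" "\<delta> < 1 / 2"
    and hides: "\<And>H. H \<in> \<H> \<Longrightarrow> hides G V (F H) H"
    and solves: "solves_HSP G V \<H> \<delta> T A"
    and "card \<H> \<ge> 2"
  shows "\<exists>H\<in>\<H>. (1 + log 2 (1 - \<delta>)) * (log 2 (card \<H>) / log_index G H) \<le> T"
proof -
  have ne: "\<H> \<noteq> {}" using assms(9) by auto
  define M where "M = Max (index_ratio G ` \<H>)"
  have "M \<in> index_ratio G ` \<H>"
    unfolding M_def using assms(4) ne by (intro Max_in) auto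
  then obtain H where H: "H \<in> \<H>" "index_ratio G H = M" by auto
  have M: "index_ratio G K \<le> M" if "K \<in> \<H>" for K
    using that assms(4) by (simp add: M_def)
  note bds = log_index_bounds[OF assms(1,2) hides[OF H(1)]]
  have "(1 - \<delta>) * card \<H> \<le> M ^ T"
    using card_candidates_le_power[OF assms(1-4) hides solves, of "card (F H ` carrier G)"] M
      index_ratio_eq_card_image[OF assms(1,2) hides[OF H(1)]] H(2) by auto
  moreover have "0 < (1 - \<delta>) * card \<H>" using assms(6,9) by simp
  ultimately have "log 2 ((1 - \<delta>) * card \<H>) \<le> log 2 (M ^ T)" by simp
  then have "log 2 (1 - \<delta>) + log 2 (card \<H>) \<le> T * log 2 M"
    using assms ne bds(1) H(2) by (simp add: log_mult log_nat_power)
  also have "\<dots> \<le> T * log_index G H"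
    using bds(3) H(2) by (intro mult_left_mono) auto
  finally have *: "log 2 (1 - \<delta>) + log 2 (card \<H>) \<le> T * log_index G H" .
  \<comment> \<open>The additive loss \<open>log 2 (1 - \<delta>)\<close> is nonpositive;
    multiplying it by a number at least 1 only lowers it, so it can be absorbed into a constant
    factor.\<close>
  have "1 \<le> log 2 (card \<H>)" using assms(9) by (simp add: le_log_iff)
  moreover have "log 2 (1 - \<delta>) \<le> 0" using assms(5,6) by simp
  ultimately have "log 2 (1 - \<delta>) * log 2 (card \<H>) \<le> log 2 (1 - \<delta>)"
    by (metis mult.right_neutral mult_left_mono_neg)
  with * have "(1 + log 2 (1 - \<delta>)) * log 2 (card \<H>) \<le> T * log_index G H"
    by (simp add: algebra_simps)
  then show ?thesis
    using H(1) bds(2) by (intro bexI[of _ H]) (auto simp: pos_divide_le_eq)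
qed

text \<open>The witness is a candidate of least index \<open>n\<close>, since the collision estimate
  needs a lower bound on all indices. Taking logarithms in the count of small patterns gives the
  claim.\<close>

lemma collision_bound:
  fixes \<epsilon> :: real
  assumes "group G" "finite (carrier G)" "finite V" "finite \<H>"
    and hides: "\<And>H. H \<in> \<H> \<Longrightarrow> hides G V (F H) H"
    and solves: "solves_HSP G V \<H> \<delta> T A"
    and "card \<H> \<ge> 2" "0 < \<epsilon>" "1 / 2 < 1 - \<delta> - \<epsilon>" "0 < T"
  shows "\<exists>H\<in>\<H>. index_ratio G H * (log 2 (card \<H>) / log_index G H) \<le> (2 / \<epsilon> + 4) * (real T)\<^sup>2"
proof -
  have ne: "\<H> \<noteq> {}" using assms(7) by auto
  define n where "n = Min (index_ratio G ` \<H>)"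
  have "n \<in> index_ratio G ` \<H>"
    unfolding n_def using assms(4) ne by (intro Min_in) auto
  then obtain H where H: "H \<in> \<H>" "index_ratio G H = n" by auto
  have le: "n \<le> index_ratio G K" if "K \<in> \<H>" for K
    using that assms(4) by (simp add: n_def)
  note bds = log_index_bounds[OF assms(1,2) hides[OF H(1)], unfolded H(2)]
  define K where "K = (real T)\<^sup>2 / (n * \<epsilon>)"
  define N where "N = card {S. S \<subseteq> {..<T} \<times> {..<T} \<and> card S \<le> K}"
  have N1: "(1 - \<delta> - \<epsilon>) * card \<H> \<le> N"
    unfolding N_def K_def
    by (rule card_candidates_le_small_patterns[OF assms(1-4) hides solves bds(1) le assms(8,10)])
  moreover have "1 / 2 * card \<H> < (1 - \<delta> - \<epsilon>) * card \<H>"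
    using assms(7,9) by (intro mult_strict_right_mono) auto
  ultimately have half: "1 / 2 * card \<H> < N" by linarith
  \<comment> \<open>\<open>N\<close> is a natural number strictly above 1. This lets the factor 2 in
    \<open>half\<close> be absorbed by squaring \<open>N\<close>, which doubles the
    logarithm.\<close>
  then have N2: "2 \<le> N" using assms(7) by linarith
  have "log 2 (card \<H>) \<le> log 2 (N * N)"
  proof -
    have "real (card \<H>) \<le> 2 * N" using half by linarith
    also have "\<dots> \<le> N * N" using N2 by simp
    finally show ?thesis using assms(7) N2 by simp
  qed
  also have "\<dots> = 2 * log 2 N" using N2 by (simp add: log_mult)
  also have "log 2 N \<le> log 2 (n powr K * exp ((real T)\<^sup>2 / n))"
    using card_small_subsets_le[of "{..<T} \<times> {..<T}" n K] bds(1) N2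
    by (simp add: N_def power2_eq_square)
  also have "\<dots> = K * log 2 n + (real T)\<^sup>2 / n / ln 2"
    using bds(1) by (simp add: log_mult log_powr)
  \<comment> \<open>The second term is brought to the shape of the first by \<open>1 / ln 2\<close>
    \<le> 2 and \<open>log_index G H\<close> \<ge> 1. Doubling the coefficients
    \<open>1 / \<epsilon>\<close> and 2 yields \<open>2 / \<epsilon> + 4\<close>.\<close>
  also have "\<dots> \<le> K * log_index G H + (real T)\<^sup>2 / n * 2 * log_index G H"
  proof (intro add_mono mult_left_mono bds(3))
    have "1 / ln 2 \<le> (2::real)" using ln2_ge_two_thirds by (simp add: field_simps)
    also have "2 \<le> 2 * log_index G H" using bds(2) by simp
    finally have "(real T)\<^sup>2 / n * (1 / ln 2) \<le> (real T)\<^sup>2 / n * (2 * log_index G H)"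
      using bds(1) by (intro mult_left_mono) auto
    then show "(real T)\<^sup>2 / n / ln 2 \<le> (real T)\<^sup>2 / n * 2 * log_index G H" by simp
  qed (use bds(1) assms(8) in \<open>simp add: K_def\<close>)
  finally have "log 2 (card \<H>) \<le> (2 / \<epsilon> + 4) * (real T)\<^sup>2 / n * log_index G H"
    using bds(1) assms(8) by (simp add: K_def field_simps)
  then have "n * (log 2 (card \<H>) / log_index G H) \<le> (2 / \<epsilon> + 4) * (real T)\<^sup>2"
    using bds(1,2) by (simp add: field_simps)
  then show ?thesis using H by auto
qed

theorem theorem2:
  fixes \<delta> :: real
  assumes "0 \<le> \<delta>" and "\<delta> < 1 / 2"
  shows "\<exists>c>0. \<forall>(G :: 'g monoid) (V :: 'v set) (\<H> :: 'g set set) (T :: nat) A.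
           group G \<longrightarrow> finite (carrier G) \<longrightarrow> finite V \<longrightarrow>
           \<H> \<noteq> {} \<longrightarrow> (\<forall>H\<in>\<H>. subgroup H G) \<longrightarrow>
           (\<forall>H\<in>\<H>. \<exists>f. hides G V f H) \<longrightarrow>
           solves_HSP G V \<H> \<delta> T A \<longrightarrow>
           real T \<ge> c * max
             (MIN H\<in>\<H>. log 2 (real (card \<H>)) / log_index G H)
             (MIN H\<in>\<H>. sqrt (index_ratio G H * (log 2 (real (card \<H>)) / log_index G H)))"
proof -
  \<comment> \<open>Half of the gap between \<delta> and \<open>1 / 2\<close>, so that
    \<open>1 - \<delta> - \<epsilon>\<close> is still above \<open>1 / 2\<close>.\<close>
  define \<epsilon> where "\<epsilon> = (1 / 2 - \<delta>) / 2"
  have \<epsilon>: "0 < \<epsilon>" "1 / 2 < 1 - \<delta> - \<epsilon>" using assms by (auto simp: \<epsilon>_def field_simps)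
  define a where "a = 1 + log 2 (1 - \<delta>)"
  have "log 2 (1 / 2) < log 2 (1 - \<delta>)" using assms by (subst log_less_cancel_iff) auto
  then have a: "0 < a" by (simp add: a_def log_divide)
  define b where "b = 2 / \<epsilon> + 4"
  have b: "0 < b" using \<epsilon> by (simp add: b_def add_pos_pos)
  define c where "c = min a (1 / sqrt b)"
  have c: "0 < c" "c \<le> a" "c \<le> 1 / sqrt b" using a b by (auto simp: c_def)
  show ?thesis
  proof (intro exI[of _ c] conjI c(1) allI impI)
    fix G :: "'g monoid" and V :: "'v set" and \<H> :: "'g set set" and T :: nat and A
    assume G: "group G" "finite (carrier G)" and V: "finite V" and ne: "\<H> \<noteq> {}"
      and sub: "\<forall>H\<in>\<H>. subgroup H G" and "\<forall>H\<in>\<H>. \<exists>f. hides G V f H"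
      and solves: "solves_HSP G V \<H> \<delta> T A"
    then obtain F where F: "\<And>H. H \<in> \<H> \<Longrightarrow> hides G V (F H) H" by metis
    have "\<H> \<subseteq> Pow (carrier G)" using sub by (auto dest: subgroup.subset)
    then have fin: "finite \<H>" using G(2) by (meson finite_Pow_iff finite_subset)
    let ?u = "\<lambda>H. log 2 (real (card \<H>)) / log_index G H"
    let ?v = "\<lambda>H. sqrt (index_ratio G H * ?u H)"
    have "\<exists>H\<in>\<H>. c * ?u H \<le> T" "\<exists>H\<in>\<H>. c * ?v H \<le> T"
    proof -
      have "card \<H> \<noteq> 0" using fin ne by simp
      then consider "card \<H> = 1" | "card \<H> \<ge> 2" by linarith
      then have "(\<exists>H\<in>\<H>. c * ?u H \<le> T) \<and> (\<exists>H\<in>\<H>. c * ?v H \<le> T)"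
      proof cases
        case 1
        \<comment> \<open>For a single candidate \<open>log 2 1 = 0\<close>, so both quantities
          vanish.\<close>
        then show ?thesis using ne by auto
      next
        case 2
        have pos: "0 \<le> ?u H" if "H \<in> \<H>" for H
          using log_index_bounds[OF G F[OF that]] 2 by auto
        obtain H where H: "H \<in> \<H>" "a * ?u H \<le> T"
          using information_bound[OF G V fin assms F solves 2] by (auto simp: a_def)
        have "c * ?u H \<le> a * ?u H" using c pos[OF H(1)] by (intro mult_right_mono)
        with H have first: "\<exists>H\<in>\<H>. c * ?u H \<le> T" by (intro bexI[of _ H]) auto
        \<comment> \<open>The collision bound requires \<open>0 < T\<close>; the first bound
          supplies it, its left-hand side being positive.\<close>
        have "0 < ?u H" using log_index_bounds[OF G F[OF H(1)]] 2 by simp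
        then have "0 < a * ?u H" using a by (rule mult_pos_pos[rotated])
        then have T: "0 < T" using H(2) by linarith
        obtain H' where H': "H' \<in> \<H>" "index_ratio G H' * ?u H' \<le> b * (real T)\<^sup>2"
          using collision_bound[OF G V fin F solves 2 \<epsilon> T] by (auto simp: b_def)
        have "c * ?v H' \<le> 1 / sqrt b * ?v H'"
          using c pos[OF H'(1)] log_index_bounds(1)[OF G F[OF H'(1)]]
          by (intro mult_right_mono real_sqrt_ge_zero mult_nonneg_nonneg) auto
        also have "\<dots> \<le> 1 / sqrt b * sqrt (b * (real T)\<^sup>2)"
          using H'(2) b by (intro mult_left_mono real_sqrt_le_mono) auto
        also have "\<dots> = T" using b by (simp add: real_sqrt_mult)
        finally show ?thesis using first H'(1) by auto
      qed
      then show "\<exists>H\<in>\<H>. c * ?u H \<le> T" "\<exists>H\<in>\<H>. c * ?v H \<le> T" by auto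
    qed
    \<comment> \<open>One witness per bound suffices, and the two witnesses may differ, because each
      minimum lies below the value at its own witness.\<close>
    moreover have "c * Min (g ` \<H>) \<le> c * g H" if "H \<in> \<H>" for g H
      using that fin c(1) by (intro mult_left_mono) auto
    ultimately have "c * Min (?u ` \<H>) \<le> T" "c * Min (?v ` \<H>) \<le> T"
      by (meson order_trans)+
    then show "c * max (Min (?u ` \<H>)) (Min (?v ` \<H>)) \<le> T"
      by (simp add: max_def)
  qed
qed

end
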